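(* Let $\mathbb{F}=\mathbb{R}$ or $\mathbb{F}=\mathbb{C}$, let $n\geq 1$, let $\preceq$ be a partial order on $\{1,\ldots,n\}$, and let $\mathcal{A}=\mathcal{A}_n(\preceq,\mathbb{F})$ be the incidence algebra. Then two matrices generate $\mathcal{A}$ with probability $1$; that is, if $\mathbf{S}$ is the Euclidean unit sphere in $\mathcal{A}^2$ and $P$ is the uniform probability measure on $\mathbf{S}$ (defined in the context), then $P(\mathbf{S}\cap\mathrm{Gen}_2(\mathcal{A},\mathbb{F}))=1$.
   Context: The incidence algebra is $\mathcal{A}_n(\preceq,\mathbb{F})=\{A\in M_n(\mathbb{F})\mid (A)_{ij}=0 \text{ for all pairs } i\not\preceq j\}$, where $(A)_{ij}$ is the $(i,j)$-th entry of $A$. Put $\rho=\dim_{\mathbb{F}}\mathcal{A}=|\{(i,j)\mid i\preceq j\}|$. $\mathrm{Gen}_2(\mathcal{A},\mathbb{F})$ is the set of pairs $(A_1,A_2)\in\mathcal{A}^2$ such that $\{A_1,A_2\}\cup\mathbb{F}I_n$ generates $\mathcal{A}$ as a ring (the smallest subring of $\mathcal{A}$ containing this set is $\mathcal{A}$), where $\mathbb{F}I_n$ is the set of scalar matrices; equivalently, $A_1,A_2$ generate $\mathcal{A}$ as a unital $\mathbb{F}$-algebra. The space $\mathcal{A}^2$ is identified, via matrix entries at positions $i\preceq j$, with $\mathbb{R}^{N}$, where $N=2\rho$ if $\mathbb{F}=\mathbb{R}$ and $N=4\rho$ if $\mathbb{F}=\mathbb{C}$ (using $\mathbb{C}\cong\mathbb{R}^2$),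 with the standard Euclidean norm. $\mathbf{S}$ is the unit sphere of $\mathbb{R}^N$ (of dimension $N-1$), and $\mu$ is the Lebesgue measure on $\mathbb{R}^N$. For $\Pi\subseteq\mathbf{S}$, the cone over $\Pi$ is $\mathcal{K}(\Pi)=\bigcup_{(A_1,A_2)\in\Pi}\{(tA_1,tA_2)\mid t\in[0,1]\}$. A subset $\Pi\subseteq\mathbf{S}$ is measurable iff $\mathcal{K}(\Pi)$ is Lebesgue-measurable, and then $P(\Pi)=\mu(\mathcal{K}(\Pi))/\mu(\mathcal{K}(\mathbf{S}))$; here $\mathcal{K}(\mathbf{S})$ is the unit ball. *)

theory Defs
  imports "HOL-Analysis.Analysis" "HOL-Algebra.Generated_Rings"
begin

definition incidence_algebra :: "('n::finite \<times> 'n) set \<Rightarrow> ('a::field ^ 'n ^ 'n) set" where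
  "incidence_algebra r = {A. \<forall>i j. (i, j) \<notin> r \<longrightarrow> A $ i $ j = 0}"

text \<open>On the type of square matrices the overloaded \<open>*\<close> and \<open>1\<close> are componentwise,
  so the ring structure is given with \<open>**\<close> and \<open>mat 1\<close>; the scalar matrices are \<open>range mat\<close>.\<close>

definition incidence_ring :: "('n::finite \<times> 'n) set \<Rightarrow> ('a::field ^ 'n ^ 'n) ring" where
  "incidence_ring r =
     \<lparr>carrier = incidence_algebra r, mult = (**), one = mat 1, zero = 0, add = (+)\<rparr>"

definition Gen2 :: "('n::finite \<times> 'n) set \<Rightarrow> (('a::field ^ 'n ^ 'n) \<times> ('a ^ 'n ^ 'n)) set" where
  "Gen2 r = {(A1, A2). A1 \<in> incidence_algebra r \<and> A2 \<in> incidence_algebra r \<and>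
     generate_ring (incidence_ring r) ({A1, A2} \<union> range mat) = incidence_algebra r}"

text \<open>Real coordinates of a pair of matrices: \<open>(k, (i, j), b)\<close> stands for the component
  along \<open>b\<close> of the \<open>(i, j)\<close> entry of the \<open>k\<close>-th matrix. As
  \<open>Basis = {1}\<close> for the reals and \<open>Basis = {1, \<i>}\<close> for the complex numbers, there are
  \<open>2 * card r\<close> and \<open>4 * card r\<close> coordinates, respectively.\<close>

definition coord_index :: "('n \<times> 'n) set \<Rightarrow> (nat \<times> ('n \<times> 'n) \<times> 'a::euclidean_space) set" where
  "coord_index r = {1, 2} \<times> r \<times> Basis"

definition coords :: "('n::finite \<times> 'n) set \<Rightarrow> ('a::euclidean_space ^ 'n ^ 'n) \<times> ('a ^ 'n ^ 'n)
    \<Rightarrow> nat \<times> ('n \<times> 'n) \<times> 'a \<Rightarrow> real" where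
  "coords r = (\<lambda>(A1, A2). \<lambda>(k, (i, j), b) \<in> coord_index r.
     (if k = 1 then A1 else A2) $ i $ j \<bullet> b)"

definition lebesgue_coords ::
    "('n::finite \<times> 'n) set \<Rightarrow> (nat \<times> ('n \<times> 'n) \<times> 'a::euclidean_space \<Rightarrow> real) measure" where
  "lebesgue_coords r = completion (\<Pi>\<^sub>M c \<in> coord_index r. lborel)"

text \<open>The library norm on pairs of matrices is the Euclidean norm of the entries, hence of
  the coordinates; see \<open>norm_eq_L2_coords\<close> below.\<close>

definition unit_sphere ::
    "('n::finite \<times> 'n) set \<Rightarrow> (('a::real_normed_field ^ 'n ^ 'n) \<times> ('a ^ 'n ^ 'n)) set" where
  "unit_sphere r = {p \<in> incidence_algebra r \<times> incidence_algebra r. norm p = 1}"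

definition cone_over :: "'b::real_vector set \<Rightarrow> 'b set" where
  "cone_over X = (\<Union>p\<in>X. {t *\<^sub>R p | t. t \<in> {0..1}})"

definition sphere_measurable ::
    "('n::finite \<times> 'n) set \<Rightarrow> (('a::{real_normed_field, euclidean_space} ^ 'n ^ 'n) \<times> ('a ^ 'n ^ 'n)) set
      \<Rightarrow> bool" where
  "sphere_measurable r X \<longleftrightarrow> X \<subseteq> unit_sphere r \<and>
     coords r ` cone_over X \<in> sets (lebesgue_coords r)"

definition sphere_prob ::
    "('n::finite \<times> 'n) set \<Rightarrow> (('a::{real_normed_field, euclidean_space} ^ 'n ^ 'n) \<times> ('a ^ 'n ^ 'n)) set
      \<Rightarrow> real" where
  "sphere_prob r X =
     measure (lebesgue_coords r) (coords r ` cone_over X) /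
     measure (lebesgue_coords r) (coords r ` cone_over
       (unit_sphere r :: (('a ^ 'n ^ 'n) \<times> ('a ^ 'n ^ 'n)) set))"

lemma ring_incidence_ring:
  assumes "partial_order_on UNIV r"
  shows "ring (incidence_ring r :: ('a::field ^ 'n::finite ^ 'n) ring)"
proof -
  have refl: "(i, i) \<in> r" for i
    using assms by (auto simp: partial_order_on_def preorder_on_def refl_on_def)
  have trans: "(i, k) \<in> r" if "(i, j) \<in> r" "(j, k) \<in> r" for i j k
    using assms that by (auto simp: partial_order_on_def preorder_on_def dest: transD)
  have mult: "A ** B \<in> incidence_algebra r"
    if "A \<in> incidence_algebra r" "B \<in> incidence_algebra r" for A B :: "'a ^ 'n ^ 'n"
  proof -
    have "A $ i $ k * B $ k $ j = 0" if "(i, j) \<notin> r" for i j k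
      using trans[of i k j] that \<open>A \<in> _\<close> \<open>B \<in> _\<close> by (auto simp: incidence_algebra_def)
    then show ?thesis
      by (auto simp: incidence_algebra_def matrix_matrix_mult_def intro!: sum.neutral)
  qed
  show ?thesis
  proof (rule ringI)
    show "abelian_group (incidence_ring r :: ('a ^ 'n ^ 'n) ring)"
    proof (rule abelian_groupI)
      fix A :: "'a ^ 'n ^ 'n"
      assume "A \<in> carrier (incidence_ring r)"
      then show "\<exists>B\<in>carrier (incidence_ring r).
          B \<oplus>\<^bsub>incidence_ring r\<^esub> A = \<zero>\<^bsub>incidence_ring r\<^esub>"
        by (intro bexI[of _ "- A"]) (auto simp: incidence_ring_def incidence_algebra_def)
    qed (auto simp: incidence_ring_def incidence_algebra_def)
    show "monoid (incidence_ring r :: ('a ^ 'n ^ 'n) ring)"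
    proof (rule monoidI)
      show "\<one>\<^bsub>incidence_ring r\<^esub> \<in> carrier (incidence_ring r :: ('a ^ 'n ^ 'n) ring)"
        using refl by (auto simp: incidence_ring_def incidence_algebra_def mat_def)
    qed (auto simp: incidence_ring_def mult matrix_mul_assoc)
  qed (auto simp: incidence_ring_def matrix_add_ldistrib vec_eq_iff
      matrix_matrix_mult_def ring_distribs sum.distrib)
qed

lemma norm_eq_L2_coords:
  fixes p :: "('a::{real_normed_field, euclidean_space} ^ 'n::finite ^ 'n) \<times> ('a ^ 'n ^ 'n)"
  assumes "p \<in> incidence_algebra r \<times> incidence_algebra r"
  shows "norm p = L2_set (coords r p) (coord_index r)"
proof -
  obtain A1 A2 where p: "p = (A1, A2)" and A: "A1 \<in> incidence_algebra r" "A2 \<in> incidence_algebra r"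
    using assms by auto
  have sq: "(norm B)\<^sup>2 = (\<Sum>(i, j)\<in>r. \<Sum>b\<in>Basis. (B $ i $ j \<bullet> b)\<^sup>2)"
    if "B \<in> incidence_algebra r" for B :: "'a ^ 'n ^ 'n"
  proof -
    have "(norm B)\<^sup>2 = (\<Sum>i\<in>UNIV. \<Sum>j\<in>UNIV. (norm (B $ i $ j))\<^sup>2)"
      by (simp add: norm_vec_def L2_set_def sum_nonneg)
    also have "\<dots> = (\<Sum>(i, j)\<in>UNIV. (norm (B $ i $ j))\<^sup>2)"
      by (simp add: sum.cartesian_product)
    also have "\<dots> = (\<Sum>(i, j)\<in>r. (norm (B $ i $ j))\<^sup>2)"
      using that by (intro sum.mono_neutral_right) (auto simp: incidence_algebra_def)
    also have "\<dots> = (\<Sum>(i, j)\<in>r. \<Sum>b\<in>Basis. (B $ i $ j \<bullet> b)\<^sup>2)"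
      by (intro sum.cong refl) (auto simp: norm_eq_sqrt_inner euclidean_inner[of "B $ _ $ _" "B $ _ $ _"]
          power2_eq_square sum_nonneg)
    finally show ?thesis .
  qed
  have "(\<Sum>c\<in>coord_index r. (coords r p c)\<^sup>2) =
      (\<Sum>(k, (i, j), b)\<in>{1, 2} \<times> r \<times> Basis. ((if k = (1::nat) then A1 else A2) $ i $ j \<bullet> b)\<^sup>2)"
    unfolding p by (intro sum.cong) (auto simp: coord_index_def coords_def)
  also have "\<dots> = (\<Sum>k\<in>{1::nat, 2}. \<Sum>(i, j)\<in>r. \<Sum>b\<in>Basis.
      ((if k = 1 then A1 else A2) $ i $ j \<bullet> b)\<^sup>2)"
    by (simp only: sum.cartesian_product' case_prod_unfold fst_conv snd_conv)
  also have "\<dots> = (norm p)\<^sup>2"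
    using A by (simp add: p norm_Pair flip: sq)
  finally show ?thesis
    by (simp add: L2_set_def)
qed

end

theory Submission
  imports Defs
begin

text \<open>
  For \<open>A\<close> in the incidence algebra, write \<open>a\<^sub>l\<close> for its diagonal entries and let
  \<open>Q\<^sub>i\<close> be the product of the factors \<open>A - a\<^sub>l I\<close> over \<open>l \<noteq> i\<close>. As \<open>A\<close> is triangular with
  respect to a linear extension of the order, its characteristic polynomial is the product over
  all \<open>l\<close>; so if the \<open>a\<^sub>l\<close> are distinct, \<open>Q\<^sub>i\<close> is a nonzero multiple of the
  spectral projection of \<open>A\<close> for \<open>a\<^sub>i\<close>. These projections are the diagonal matrix units up to
  a conjugation that diagonalizes \<open>A\<close>, and a second matrix \<open>B\<close> is cut by them into the pieces
  \<open>Q\<^sub>i B Q\<^sub>j\<close>, which for generic \<open>B\<close> span the incidence algebra.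

  The proof makes this precise without the conjugation. The entry of \<open>Q\<^sub>i\<close> at \<open>(k, p)\<close> vanishes
  unless \<open>k \<preceq> i \<preceq> p\<close> (\<open>spectral_factor_zero\<close>), so \<open>Q\<^sub>i B Q\<^sub>j\<close> is supported on the intervals that
  contain \<open>[i, j]\<close>. If its entry at \<open>(i, j)\<close> is nonzero for all \<open>i \<preceq> j\<close>, then all matrix units
  lie in the algebra generated by \<open>A\<close> and \<open>B\<close>, by induction from large intervals to small ones
  (\<open>incidence_algebra_subset_subalgebra\<close>).

  It remains to see that these finitely many conditions fail only on a null set
  (\<open>null_sets_not_Gen2_coords\<close>). Coincidences \<open>a\<^sub>i = a\<^sub>k\<close> restrict one coordinate to a single
  value when the others are fixed. Away from them, the entry of \<open>Q\<^sub>i B Q\<^sub>j\<close> at \<open>(i, j)\<close>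
  depends on the entry \<open>b\<close> of \<open>B\<close> at \<open>(i, j)\<close> through the summand
  \<open>(Q\<^sub>i)\<^sub>i\<^sub>i b (Q\<^sub>j)\<^sub>j\<^sub>j\<close> with nonzero coefficients, so again one coordinate is determined by the
  others. By Fubini such sets are null. The argument is uniform in the field, which enters
  only as a Euclidean space that is a normed field.

  Finally, a pair generates as soon as some multiple of it does. Hence the points that the cone over
  the generating part of the sphere misses in the unit ball are non-generating pairs, and the two
  cones have the same measure.
\<close>

section \<open>Arithmetic of the incidence algebra\<close>

lemma mat_mult_component: "(mat c ** A) $ i $ j = (c::'a::field) * A $ i $ j"
  by (simp add: matrix_matrix_mult_def mat_def if_distrib if_distribR cong: if_cong)

lemma mult_mat_component: "(A ** mat c) $ i $ j = A $ i $ j * (c::'a::field)"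
  by (simp add: matrix_matrix_mult_def mat_def if_distrib if_distribR cong: if_cong)

lemma mat_mult_commute: "mat c ** A = A ** mat (c::'a::field)"
  by (simp add: vec_eq_iff mat_mult_component mult_mat_component mult.commute)

lemma matrix_mult_add_rdistrib:
  "(A + B) ** C = A ** C + B ** (C :: 'a::field ^ 'n::finite ^ 'm::finite)"
  by (simp add: vec_eq_iff matrix_matrix_mult_def distrib_right sum.distrib)

text \<open>This lets the product over a set of factors \<open>A - mat a\<close> be formed without choosing an order.\<close>

lemma minus_mat_mult_left_commute:
  fixes A B :: "'a::field ^ 'n::finite ^ 'n"
  shows "(A - mat a) ** ((A - mat b) ** B) = (A - mat b) ** ((A - mat a) ** B)"
proof -
  have mats: "mat x ** mat y = (mat (x * y) :: 'a ^ 'n ^ 'n)" for x y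
    by (simp add: vec_eq_iff mat_mult_component) (simp add: mat_def)
  have expand: "(A + mat x) ** (A + mat y) = A ** A + (mat x ** A + mat y ** A) + mat (x * y)" for x y
    by (simp add: matrix_add_ldistrib matrix_mult_add_rdistrib mats mat_mult_commute[of y] algebra_simps)
  have minus: "A - mat x = A + mat (- x)" for x
    by (simp add: vec_eq_iff mat_def)
  have "(A - mat a) ** (A - mat b) = (A - mat b) ** (A - mat a)"
    by (simp add: minus expand add.commute mult.commute)
  then show ?thesis
    by (simp add: matrix_mul_assoc)
qed

context
  fixes r :: "('n::finite \<times> 'n) set"
  assumes po: "partial_order_on UNIV r"
begin

lemma order_refl: "(i, i) \<in> r"
  using po by (auto simp: partial_order_on_def preorder_on_def refl_on_def)

lemma order_trans: "(i, j) \<in> r \<Longrightarrow> (j, k) \<in> r \<Longrightarrow> (i, k) \<in> r"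
  using po by (auto simp: partial_order_on_def preorder_on_def dest: transD)

lemma order_antisym: "(i, j) \<in> r \<Longrightarrow> (j, i) \<in> r \<Longrightarrow> i = j"
  using po by (auto simp: partial_order_on_def dest: antisymD)

lemma incidence_algebra_mult:
  assumes "A \<in> incidence_algebra r" "B \<in> incidence_algebra r"
  shows "A ** B \<in> incidence_algebra r"
proof -
  have "A $ i $ k * B $ k $ j = 0" if "(i, j) \<notin> r" for i j k
    using order_trans[of i k j] that assms by (auto simp: incidence_algebra_def)
  then show ?thesis
    by (auto simp: incidence_algebra_def matrix_matrix_mult_def intro!: sum.neutral)
qed

lemma incidence_algebra_mat: "mat c \<in> incidence_algebra r"
  using order_refl by (auto simp: incidence_algebra_def mat_def)

lemma incidence_algebra_diff:
  "A \<in> incidence_algebra r \<Longrightarrow> B \<in> incidence_algebra r \<Longrightarrow> A - B \<in> incidence_algebra r"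
  by (auto simp: incidence_algebra_def)

lemma incidence_algebra_mult_diagonal:
  assumes "A \<in> incidence_algebra r" "B \<in> incidence_algebra r"
  shows "(A ** B) $ i $ i = A $ i $ i * B $ i $ i"
proof -
  have "A $ i $ k * B $ k $ i = 0" if "k \<noteq> i" for k
    using assms order_antisym[of i k] that by (auto simp: incidence_algebra_def)
  then have "(\<Sum>k\<in>UNIV. A $ i $ k * B $ k $ i) = (\<Sum>k\<in>{i}. A $ i $ k * B $ k $ i)"
    by (intro sum.mono_neutral_right) auto
  then show ?thesis
    by (simp add: matrix_matrix_mult_def)
qed

end

section \<open>Products of the factors of the characteristic polynomial\<close>

definition char_product :: "'a::field ^ 'n::finite ^ 'n \<Rightarrow> 'n set \<Rightarrow> 'a ^ 'n ^ 'n" where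
  "char_product A S = Finite_Set.fold (\<lambda>l B. (A - mat (A $ l $ l)) ** B) (mat 1) S"

lemma char_product_empty: "char_product A {} = mat 1"
  by (simp add: char_product_def)

lemma char_product_insert:
  fixes A :: "'a::field ^ 'n::finite ^ 'n"
  shows "l \<notin> S \<Longrightarrow> char_product A (insert l S) = (A - mat (A $ l $ l)) ** char_product A S"
proof -
  interpret comp_fun_commute "\<lambda>l (B :: 'a ^ 'n ^ 'n). (A - mat (A $ l $ l)) ** B"
    by unfold_locales (auto simp: fun_eq_iff intro: minus_mat_mult_left_commute)
  assume "l \<notin> S"
  then show ?thesis
    by (simp add: char_product_def)
qed

text \<open>For a triangular \<open>A\<close> with distinct diagonal entries, this is a multiple of the spectral
  projection for the eigenvalue \<open>A $ i $ i\<close>, given by Lagrange interpolation.\<close>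

definition spectral_factor :: "'a::field ^ 'n::finite ^ 'n \<Rightarrow> 'n \<Rightarrow> 'a ^ 'n ^ 'n" where
  "spectral_factor A i = char_product A (UNIV - {i})"

definition matrix_unit :: "'n::finite \<Rightarrow> 'n \<Rightarrow> 'a::field \<Rightarrow> 'a ^ 'n ^ 'n" where
  "matrix_unit i j c = (\<chi> k l. if k = i \<and> l = j then c else 0)"

lemma matrix_unit_component: "matrix_unit i j c $ k $ l = (if k = i \<and> l = j then c else 0)"
  by (simp add: matrix_unit_def)

lemma sandwich_matrix_unit_component:
  "(P ** matrix_unit i j c ** Q) $ k $ l = P $ k $ i * c * Q $ j $ l"
proof -
  have "(P ** matrix_unit i j c) $ k $ q = (if q = j then P $ k $ i * c else 0)" for q
    by (simp add: matrix_matrix_mult_def matrix_unit_component if_distrib if_distribR cong: if_cong)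
  then have "(P ** matrix_unit i j c ** Q) $ k $ l = (\<Sum>q\<in>UNIV. (if q = j then P $ k $ i * c else 0) * Q $ q $ l)"
    by (simp add: matrix_matrix_mult_def[of "P ** matrix_unit i j c"])
  also have "\<dots> = (\<Sum>q\<in>UNIV. if q = j then P $ k $ i * c * Q $ q $ l else 0)"
    by (intro sum.cong) auto
  finally show ?thesis
    by simp
qed

lemma matrix_eq_sum_units:
  "(A :: 'a::field ^ 'n::finite ^ 'n) = (\<Sum>(k, l)\<in>UNIV. matrix_unit k l (A $ k $ l))"
proof -
  have "(\<Sum>(k, l)\<in>UNIV. matrix_unit k l (A $ k $ l)) $ i $ j =
      (\<Sum>p\<in>UNIV. if p = (i, j) then A $ i $ j else 0)" for i j
    unfolding sum_component by (intro sum.cong) (auto simp: matrix_unit_component split: if_splits)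
  then show ?thesis
    by (simp add: vec_eq_iff)
qed

context
  fixes r :: "('n::finite \<times> 'n) set" and A :: "'a::field ^ 'n ^ 'n"
  assumes po: "partial_order_on UNIV r" and A: "A \<in> incidence_algebra r"
begin

lemma char_product_in_incidence_algebra: "char_product A S \<in> incidence_algebra r"
proof (induction S rule: finite_induct[OF finite])
  case 1 then show ?case by (simp add: char_product_empty incidence_algebra_mat[OF po])
next
  case (2 l S)
  then show ?case
    by (simp add: char_product_insert incidence_algebra_mult[OF po] incidence_algebra_diff[OF po] A
        incidence_algebra_mat[OF po])
qed

lemma char_product_diagonal: "char_product A S $ k $ k = (\<Prod>l\<in>S. A $ k $ k - A $ l $ l)"
proof (induction S rule: finite_induct[OF finite])
  case 1 then show ?case by (simp add: char_product_empty mat_def)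
next
  case (2 l S)
  then show ?case
    by (simp add: char_product_insert incidence_algebra_mult_diagonal[OF po] A
        incidence_algebra_diff[OF po] incidence_algebra_mat[OF po] char_product_in_incidence_algebra)
       (simp add: mat_def)
qed

text \<open>A local form of the theorem of Cayley and Hamilton: the entry at \<open>(k, p)\<close> of a product in the
  incidence algebra only depends on the entries indexed by the interval from \<open>k\<close> to \<open>p\<close>, and
  \<open>S\<close> supplies all factors of the characteristic polynomial of that submatrix. The factor for \<open>k\<close>
  is split off on the left: it has a zero at \<open>(k, k)\<close>, so only rows strictly above \<open>k\<close> of the
  remaining product contribute.\<close>

lemma char_product_zero:
  assumes "{q. (k, q) \<in> r \<and> (q, p) \<in> r} \<subseteq> S"
  shows "char_product A S $ k $ p = 0"
  using assms
proof (induction "card S" arbitrary: S k rule: less_induct)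
  case less
  show ?case
  proof (cases "(k, p) \<in> r")
    case False
    then show ?thesis
      using char_product_in_incidence_algebra by (auto simp: incidence_algebra_def)
  next
    case True
    with less.prems have k: "k \<in> S"
      using order_refl[OF po] by auto
    let ?D = "A - mat (A $ k $ k)" and ?M = "char_product A (S - {k})"
    have "?D $ k $ q * ?M $ q $ p = 0" for q
    proof (cases "q = k \<or> (k, q) \<notin> r")
      case True
      then show ?thesis
        using A order_refl[OF po] by (auto simp: mat_def incidence_algebra_def)
    next
      case False
      \<comment> \<open>by antisymmetry, an interval that starts strictly above \<open>k\<close> does not contain \<open>k\<close>\<close>
      have "{s. (q, s) \<in> r \<and> (s, p) \<in> r} \<subseteq> S - {k}"
        using less.prems False order_trans[OF po, of k q] order_antisym[OF po, of k q] by auto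
      with less.hyps[of "S - {k}" q] k have "?M $ q $ p = 0"
        by (metis card_Diff1_less finite)
      then show ?thesis by simp
    qed
    moreover have "char_product A S = ?D ** ?M"
      using char_product_insert[of k "S - {k}" A] k by (simp add: insert_absorb)
    moreover have "(?D ** ?M) $ k $ p = (\<Sum>q\<in>UNIV. ?D $ k $ q * ?M $ q $ p)"
      by (simp add: matrix_matrix_mult_def)
    ultimately show ?thesis
      by (metis (no_types, lifting) sum.neutral)
  qed
qed

lemma spectral_factor_zero:
  "(k, i) \<notin> r \<or> (i, p) \<notin> r \<Longrightarrow> spectral_factor A i $ k $ p = 0"
  unfolding spectral_factor_def by (rule char_product_zero) auto

lemma spectral_factor_diagonal:
  "spectral_factor A i $ i $ i = (\<Prod>l\<in>UNIV - {i}. A $ i $ i - A $ l $ l)"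
  by (simp add: spectral_factor_def char_product_diagonal)

lemma spectral_sandwich_zero:
  assumes "(k, i) \<notin> r \<or> (j, l) \<notin> r"
  shows "(spectral_factor A i ** B ** spectral_factor A j) $ k $ l = 0"
proof (cases "(k, i) \<in> r")
  case True
  with assms show ?thesis
    by (simp add: matrix_matrix_mult_def spectral_factor_zero)
next
  case False
  then show ?thesis
    by (simp add: matrix_matrix_mult_def spectral_factor_zero)
qed

end

section \<open>A sufficient condition for generation\<close>

lemma char_product_mem:
  fixes R :: "('a::field ^ 'n::finite ^ 'n) set"
  assumes scal: "\<And>c. mat c \<in> R"
    and add: "\<And>X Y. X \<in> R \<Longrightarrow> Y \<in> R \<Longrightarrow> X + Y \<in> R"
    and mult: "\<And>X Y. X \<in> R \<Longrightarrow> Y \<in> R \<Longrightarrow> X ** Y \<in> R"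
    and "A \<in> R"
  shows "char_product A S \<in> R"
proof (induction S rule: finite_induct[OF finite])
  case 1 then show ?case by (simp add: char_product_empty scal)
next
  case (2 l S)
  have "A - mat (A $ l $ l) = A + mat (- (A $ l $ l))"
    by (simp add: vec_eq_iff mat_def)
  then have "A - mat (A $ l $ l) \<in> R"
    using add[OF \<open>A \<in> R\<close> scal] by metis
  with 2 show ?case
    by (simp add: char_product_insert mult)
qed

text \<open>By \<open>spectral_sandwich_zero\<close> the matrix \<open>spectral_factor A i ** B ** spectral_factor A j\<close>
  is a nonzero multiple of the matrix unit at \<open>(i, j)\<close> plus a combination of matrix units at pairs
  whose intervals properly contain the one from \<open>i\<close> to \<open>j\<close>. Hence all matrix units are obtained by
  induction, starting with the maximal intervals.\<close>

lemma incidence_algebra_subset_subalgebra: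
  fixes r :: "('n::finite \<times> 'n) set" and R :: "('a::field ^ 'n ^ 'n) set"
  assumes po: "partial_order_on UNIV r"
    and scal: "\<And>c. mat c \<in> R"
    and add: "\<And>X Y. X \<in> R \<Longrightarrow> Y \<in> R \<Longrightarrow> X + Y \<in> R"
    and mult: "\<And>X Y. X \<in> R \<Longrightarrow> Y \<in> R \<Longrightarrow> X ** Y \<in> R"
    and A: "A \<in> R" "A \<in> incidence_algebra r" and B: "B \<in> R"
    and nz: "\<And>i j. (i, j) \<in> r \<Longrightarrow> (spectral_factor A i ** B ** spectral_factor A j) $ i $ j \<noteq> 0"
  shows "incidence_algebra r \<subseteq> R"
proof
  have zero: "0 \<in> R"
    using scal[of 0] by simp
  have sum: "sum f T \<in> R" if "\<And>x. x \<in> T \<Longrightarrow> f x \<in> R" for f and T :: "('n \<times> 'n) set"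
    using that by (induction T rule: infinite_finite_induct) (auto simp: zero add)
  have uminus: "- X \<in> R" if "X \<in> R" for X
  proof -
    have "- X = mat (- 1) ** X"
      by (simp add: vec_eq_iff mat_mult_component)
    then show ?thesis by (simp add: mult scal that)
  qed
  have units: "matrix_unit i j c \<in> R" if "(i, j) \<in> r" for i j c
    using that
  proof (induction "card {(k, l). (k, i) \<in> r \<and> (j, l) \<in> r}" arbitrary: i j c rule: less_induct)
    case less
    define G where "G = spectral_factor A i ** B ** spectral_factor A j"
    have G: "G \<in> R"
      unfolding G_def spectral_factor_def by (intro mult char_product_mem scal add A B)
    have rest: "matrix_unit k l (G $ k $ l) \<in> R" if "(k, l) \<noteq> (i, j)" for k l
    proof (cases "(k, i) \<in> r \<and> (j, l) \<in> r")
      case True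
      have "{(k', l'). (k', k) \<in> r \<and> (l, l') \<in> r} \<subset> {(k', l'). (k', i) \<in> r \<and> (j, l') \<in> r}"
      proof (rule psubsetI)
        show "{(k', l'). (k', k) \<in> r \<and> (l, l') \<in> r} \<subseteq> {(k', l'). (k', i) \<in> r \<and> (j, l') \<in> r}"
          using True order_trans[OF po] by blast
        have "(i, j) \<notin> {(k', l'). (k', k) \<in> r \<and> (l, l') \<in> r}"
          using True \<open>(k, l) \<noteq> (i, j)\<close> order_antisym[OF po] by blast
        moreover have "(i, j) \<in> {(k', l'). (k', i) \<in> r \<and> (j, l') \<in> r}"
          using order_refl[OF po] by blast
        ultimately show "{(k', l'). (k', k) \<in> r \<and> (l, l') \<in> r} \<noteq> {(k', l'). (k', i) \<in> r \<and> (j, l') \<in> r}"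
          by blast
      qed
      then have "card {(k', l'). (k', k) \<in> r \<and> (l, l') \<in> r} < card {(k', l'). (k', i) \<in> r \<and> (j, l') \<in> r}"
        by (intro psubset_card_mono) auto
      moreover have "(k, l) \<in> r"
        using True less.prems order_trans[OF po] by blast
      ultimately show ?thesis
        by (rule less.hyps)
    next
      case False
      then have "G $ k $ l = 0"
        unfolding G_def by (intro spectral_sandwich_zero[OF po A(2)]) auto
      then have "matrix_unit k l (G $ k $ l) = 0"
        by (simp add: vec_eq_iff matrix_unit_component)
      then show ?thesis
        using zero by simp
    qed
    have "G = matrix_unit i j (G $ i $ j) + (\<Sum>(k, l)\<in>UNIV - {(i, j)}. matrix_unit k l (G $ k $ l))"
      by (subst matrix_eq_sum_units, subst sum.remove[of _ "(i, j)"]) auto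
    then have "matrix_unit i j (G $ i $ j) =
        G + - (\<Sum>(k, l)\<in>UNIV - {(i, j)}. matrix_unit k l (G $ k $ l))"
      by (simp add: algebra_simps)
    also have "\<dots> \<in> R"
      using rest by (intro add G uminus sum) auto
    finally have "mat (c / G $ i $ j) ** matrix_unit i j (G $ i $ j) \<in> R"
      by (intro mult scal)
    also have "mat (c / G $ i $ j) ** matrix_unit i j (G $ i $ j) = matrix_unit i j c"
      using nz[OF less.prems] by (simp add: vec_eq_iff mat_mult_component matrix_unit_component G_def)
    finally show ?case .
  qed
  fix X :: "'a ^ 'n ^ 'n" assume X: "X \<in> incidence_algebra r"
  have "matrix_unit k l (X $ k $ l) \<in> R" for k l
  proof (cases "(k, l) \<in> r")
    case False
    with X have "matrix_unit k l (X $ k $ l) = 0"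
      by (simp add: vec_eq_iff matrix_unit_component incidence_algebra_def)
    with zero show ?thesis by simp
  qed (rule units)
  then show "X \<in> R"
    by (subst matrix_eq_sum_units) (auto intro: sum)
qed

lemma Gen2I:
  fixes A B :: "'a::field ^ 'n::finite ^ 'n"
  assumes po: "partial_order_on UNIV r"
    and A: "A \<in> incidence_algebra r" and B: "B \<in> incidence_algebra r"
    and nz: "\<And>i j. (i, j) \<in> r \<Longrightarrow> (spectral_factor A i ** B ** spectral_factor A j) $ i $ j \<noteq> 0"
  shows "(A, B) \<in> Gen2 r"
proof -
  let ?R = "generate_ring (incidence_ring r) ({A, B} \<union> range mat)"
  interpret ring "incidence_ring r :: ('a ^ 'n ^ 'n) ring"
    by (rule ring_incidence_ring[OF po])
  have "?R \<subseteq> incidence_algebra r"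
    using generate_ring_incl[of "{A, B} \<union> range mat"] A B incidence_algebra_mat[OF po]
    by (auto simp: incidence_ring_def)
  moreover have "incidence_algebra r \<subseteq> ?R"
  proof (rule incidence_algebra_subset_subalgebra[OF po _ _ _ _ A _ nz])
    show "X + Y \<in> ?R" if "X \<in> ?R" "Y \<in> ?R" for X Y
      using generate_ring.eng_add[OF that] by (simp add: incidence_ring_def)
    show "X ** Y \<in> ?R" if "X \<in> ?R" "Y \<in> ?R" for X Y
      using generate_ring.eng_mult[OF that] by (simp add: incidence_ring_def)
  qed (auto intro: generate_ring.incl)
  ultimately have "?R = incidence_algebra r"
    by (rule subset_antisym)
  then show ?thesis
    by (simp only: Gen2_def mem_Collect_eq prod.case A B simp_thms)
qed

text \<open>For \<open>c = 0\<close> this says that if the scalars alone generate, then so does every pair; covering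
  this case saves a separate treatment of the apex of the cone.\<close>

lemma Gen2_mult_mat:
  fixes A B :: "'a::field ^ 'n::finite ^ 'n"
  assumes po: "partial_order_on UNIV r"
    and A: "A \<in> incidence_algebra r" and B: "B \<in> incidence_algebra r"
    and gen: "(mat c ** A, mat c ** B) \<in> Gen2 r"
  shows "(A, B) \<in> Gen2 r"
proof -
  let ?R = "generate_ring (incidence_ring r) ({A, B} \<union> range mat)"
  interpret ring "incidence_ring r :: ('a ^ 'n ^ 'n) ring"
    by (rule ring_incidence_ring[OF po])
  have AB: "{A, B} \<union> range mat \<subseteq> carrier (incidence_ring r)"
    using A B incidence_algebra_mat[OF po] by (auto simp: incidence_ring_def)
  have mult: "mat c ** X \<in> ?R" if "X \<in> {A, B}" for X
    using generate_ring.eng_mult[of "mat c" "incidence_ring r" "{A, B} \<union> range mat" X] that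
    by (auto simp: incidence_ring_def intro: generate_ring.incl)
  have "generate_ring (incidence_ring r) ({mat c ** A, mat c ** B} \<union> range mat) \<subseteq> ?R"
  proof (rule generate_ring_min_subring1)
    show "{mat c ** A, mat c ** B} \<union> range mat \<subseteq> carrier (incidence_ring r)"
      using A B incidence_algebra_mat[OF po] incidence_algebra_mult[OF po]
      by (auto simp: incidence_ring_def)
    show "subring ?R (incidence_ring r)"
      by (rule generate_ring_is_subring[OF AB])
    show "{mat c ** A, mat c ** B} \<union> range mat \<subseteq> ?R"
      using mult by (auto intro: generate_ring.incl)
  qed
  moreover have "?R \<subseteq> incidence_algebra r"
    using generate_ring_incl[OF AB] by (simp add: incidence_ring_def)
  ultimately show ?thesis
    using gen by (auto simp: Gen2_def A B)
qed

section \<open>Coordinates\<close>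

definition coord_matrix ::
    "('n::finite \<times> 'n) set \<Rightarrow> nat \<Rightarrow> (nat \<times> ('n \<times> 'n) \<times> 'a::euclidean_space \<Rightarrow> real) \<Rightarrow> 'a ^ 'n ^ 'n"
  where
  "coord_matrix r m x = (\<chi> i j. if (i, j) \<in> r then \<Sum>b\<in>Basis. x (m, (i, j), b) *\<^sub>R b else 0)"

lemma coord_matrix_in_incidence_algebra:
  "coord_matrix r m x \<in> (incidence_algebra r :: ('a::{field, euclidean_space} ^ 'n::finite ^ 'n) set)"
  by (simp add: incidence_algebra_def coord_matrix_def)

lemma coords_coord_matrix:
  fixes x :: "nat \<times> ('n::finite \<times> 'n) \<times> 'a::euclidean_space \<Rightarrow> real"
  assumes "x \<in> extensional (coord_index r)"
  shows "coords r (coord_matrix r 1 x, coord_matrix r 2 x) = x"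
proof (rule extensionalityI[OF _ assms])
  show "coords r (coord_matrix r 1 x, coord_matrix r 2 x) \<in> extensional (coord_index r)"
    by (simp add: coords_def)
  fix c :: "nat \<times> ('n \<times> 'n) \<times> 'a" assume c: "c \<in> coord_index r"
  obtain k i j b where "c = (k, (i, j), b)"
    by (metis surj_pair)
  with c show "coords r (coord_matrix r 1 x, coord_matrix r 2 x) c = x c"
    by (auto simp: coords_def coord_index_def coord_matrix_def)
qed

lemma coord_matrix_coords:
  fixes A B :: "'a::{field, euclidean_space} ^ 'n::finite ^ 'n"
  assumes "A \<in> incidence_algebra r" "B \<in> incidence_algebra r"
  shows "coord_matrix r 1 (coords r (A, B)) = A" "coord_matrix r 2 (coords r (A, B)) = B"
  using assms
  by (auto simp: vec_eq_iff coord_matrix_def coords_def coord_index_def incidence_algebra_def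
      euclidean_representation)

lemma coord_matrix_upd:
  fixes b :: "'a::{real_normed_field, euclidean_space}" and r :: "('n::finite \<times> 'n) set"
  assumes ij: "(i, j) \<in> r" and b: "b \<in> Basis"
  shows "coord_matrix r m (x((m', (i, j), b) := t)) =
    coord_matrix r m x + (if m = m' then matrix_unit i j ((t - x (m, (i, j), b)) *\<^sub>R b) else 0)"
proof -
  let ?y = "x((m', (i, j), b) := t)"
  have sums: "(\<Sum>b'\<in>Basis. ?y (m, (k, l), b') *\<^sub>R b') = (\<Sum>b'\<in>Basis. x (m, (k, l), b') *\<^sub>R b') +
      (if m = m' \<and> k = i \<and> l = j then (t - x (m, (i, j), b)) *\<^sub>R b else 0)" for k l
  proof (cases "m = m' \<and> k = i \<and> l = j")
    case True
    then show ?thesis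
      using b by (simp add: sum.remove[OF finite_Basis b] algebra_simps)
  next
    case False
    then show ?thesis
      by (auto intro!: sum.cong)
  qed
  have "coord_matrix r m ?y $ k $ l = (coord_matrix r m x +
      (if m = m' then matrix_unit i j ((t - x (m, (i, j), b)) *\<^sub>R b) else 0)) $ k $ l" for k l
    using sums[of k l] ij by (auto simp: coord_matrix_def matrix_unit_component simp del: fun_upd_apply)
  then show ?thesis
    by (simp add: vec_eq_iff)
qed

section \<open>Genericity\<close>

text \<open>By Fubini, it suffices that every line in the direction of coordinate \<open>c\<close> meets \<open>Z\<close> in a null
  set.\<close>

lemma null_sets_PiM_lborel_if_unique_coordinate:
  fixes Z :: "('i \<Rightarrow> real) set"
  assumes I: "finite I" "c \<in> I" and Z: "Z \<in> sets (Pi\<^sub>M I (\<lambda>_. lborel))"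
    and unique: "\<And>x t. x \<in> Z \<Longrightarrow> x(c := t) \<in> Z \<Longrightarrow> t = x c"
  shows "Z \<in> null_sets (Pi\<^sub>M I (\<lambda>_. lborel))"
proof -
  interpret product_sigma_finite "\<lambda>_ :: 'i. lborel :: real measure" ..
  have inner: "(\<integral>\<^sup>+y. indicator Z (x(c := y)) \<partial>(lborel :: real measure)) = 0" for x
  proof -
    have "\<exists>y0. {y. x(c := y) \<in> Z} \<subseteq> {y0}"
    proof (cases "\<exists>y0. x(c := y0) \<in> Z")
      case True
      then obtain y0 where y0: "x(c := y0) \<in> Z" ..
      have "y = y0" if "x(c := y) \<in> Z" for y
        using unique[OF y0, of y] that by simp
      then show ?thesis by blast
    qed auto
    then obtain y0 where "{y. x(c := y) \<in> Z} \<subseteq> {y0}" ..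
    then have "(\<integral>\<^sup>+y. indicator Z (x(c := y)) \<partial>(lborel :: real measure)) \<le>
        (\<integral>\<^sup>+y. indicator {y0} y \<partial>(lborel :: real measure))"
      by (intro nn_integral_mono) (auto simp: indicator_def)
    also have "\<dots> = 0"
      by simp
    finally show ?thesis by simp
  qed
  have ins: "insert c (I - {c}) = I"
    using I by auto
  have "emeasure (Pi\<^sub>M I (\<lambda>_. lborel)) Z = (\<integral>\<^sup>+x. indicator Z x \<partial>Pi\<^sub>M I (\<lambda>_. lborel))"
    using Z by simp
  also have "\<dots> = (\<integral>\<^sup>+x. (\<integral>\<^sup>+y. indicator Z (x(c := y)) \<partial>lborel) \<partial>Pi\<^sub>M (I - {c}) (\<lambda>_. lborel))"
    using product_nn_integral_insert[of "I - {c}" c "indicator Z", unfolded ins] I Z by simp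
  also have "\<dots> = 0"
    by (simp add: inner)
  finally show ?thesis
    using Z by auto
qed

lemma borel_measurable_coord_matrix:
  assumes "m \<in> {1, 2}"
  shows "(\<lambda>x. coord_matrix r m x $ i $ j :: 'a::euclidean_space)
    \<in> borel_measurable (Pi\<^sub>M (coord_index r) (\<lambda>_. lborel))"
proof (cases "(i, j) \<in> r")
  case True
  have "(\<lambda>x. x (m, (i, j), b)) \<in> borel_measurable (Pi\<^sub>M (coord_index r) (\<lambda>_. lborel))"
    if "b \<in> Basis" for b :: 'a
    using measurable_component_singleton[of "(m, (i, j), b)" "coord_index r" "\<lambda>_. lborel"] assms True that
    by (simp add: coord_index_def)
  then have "(\<lambda>x. \<Sum>b\<in>Basis. x (m, (i, j), b) *\<^sub>R b :: 'a)
      \<in> borel_measurable (Pi\<^sub>M (coord_index r) (\<lambda>_. lborel))"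
    by (intro borel_measurable_sum borel_measurable_scaleR borel_measurable_const)
  then show ?thesis
    using True by (simp add: coord_matrix_def)
qed (simp add: coord_matrix_def)

lemma borel_measurable_matrix_mult:
  fixes A B :: "'b \<Rightarrow> 'a::{real_normed_field, euclidean_space} ^ 'n::finite ^ 'n"
  assumes "\<And>k l. (\<lambda>x. A x $ k $ l) \<in> borel_measurable M"
    and "\<And>k l. (\<lambda>x. B x $ k $ l) \<in> borel_measurable M"
  shows "(\<lambda>x. (A x ** B x) $ k $ l) \<in> borel_measurable M"
  using assms by (simp add: matrix_matrix_mult_def)

lemma borel_measurable_char_product:
  fixes A :: "'b \<Rightarrow> 'a::{real_normed_field, euclidean_space} ^ 'n::finite ^ 'n"
  assumes A: "\<And>k l. (\<lambda>x. A x $ k $ l) \<in> borel_measurable M"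
  shows "(\<lambda>x. char_product (A x) S $ k $ l) \<in> borel_measurable M"
proof (induction S arbitrary: k l rule: finite_induct[OF finite])
  case 1
  then show ?case by (simp add: char_product_empty)
next
  case (2 q S)
  have "(\<lambda>x. (A x - mat (A x $ q $ q)) $ k $ l) \<in> borel_measurable M" for k l
    using A by (cases "k = l") (simp_all add: mat_def)
  with 2 show ?case
    by (simp add: char_product_insert borel_measurable_matrix_mult del: vector_minus_component)
qed

text \<open>The null set is the union of the sets \<open>E i k\<close>, on which two diagonal entries of the first
  matrix coincide, and \<open>F i j\<close>, on which the condition of \<open>Gen2I\<close> at \<open>(i, j)\<close> fails
  although the diagonal entries that serve as coefficients there are nonzero. Each of them is
  Borel, so that \<open>Gen2 r\<close> becomes measurable by completeness of the Lebesgue measure.\<close>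

lemma null_sets_not_Gen2_coords:
  fixes r :: "('n::finite \<times> 'n) set"
  assumes po: "partial_order_on UNIV r"
  defines "I \<equiv> coord_index r :: (nat \<times> ('n \<times> 'n) \<times> 'a::{real_normed_field, euclidean_space}) set"
  shows "\<exists>Z \<in> null_sets (Pi\<^sub>M I (\<lambda>_. lborel)).
    \<forall>p \<in> incidence_algebra r \<times> incidence_algebra r - Gen2 r. coords r p \<in> Z"
proof -
  define M where "M = Pi\<^sub>M I (\<lambda>_. lborel :: real measure)"
  define A :: "_ \<Rightarrow> 'a ^ 'n ^ 'n" where "A x = coord_matrix r 1 x" for x
  define B :: "_ \<Rightarrow> 'a ^ 'n ^ 'n" where "B x = coord_matrix r 2 x" for x
  define g where "g i j x = (spectral_factor (A x) i ** B x ** spectral_factor (A x) j) $ i $ j" for i j x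
  define E where "E i k = {x \<in> space M. A x $ i $ i - A x $ k $ k = 0}" for i k
  define F where "F i j = {x \<in> space M. g i j x = 0 \<and>
    spectral_factor (A x) i $ i $ i \<noteq> 0 \<and> spectral_factor (A x) j $ j $ j \<noteq> 0}" for i j
  have fin: "finite I"
    by (simp add: I_def coord_index_def)
  have A_in: "A x \<in> incidence_algebra r" and B_in: "B x \<in> incidence_algebra r" for x
    by (simp_all add: A_def B_def coord_matrix_in_incidence_algebra)
  \<comment> \<open>any direction \<open>b\<close> of the field will do for the coordinate that is varied\<close>
  obtain b :: 'a where b: "b \<in> Basis"
    using nonempty_Basis by blast
  then have b0: "b \<noteq> 0"
    by auto

  have A_meas [measurable]: "(\<lambda>x. A x $ i $ j) \<in> borel_measurable M"
    and B_meas [measurable]: "(\<lambda>x. B x $ i $ j) \<in> borel_measurable M" for i j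
    unfolding A_def B_def M_def I_def by (rule borel_measurable_coord_matrix; simp)+
  have Q_meas [measurable]: "(\<lambda>x. spectral_factor (A x) i $ k $ l) \<in> borel_measurable M" for i k l
    unfolding spectral_factor_def by (intro borel_measurable_char_product A_meas)
  have g_meas [measurable]: "g i j \<in> borel_measurable M" for i j
    unfolding g_def by (intro borel_measurable_matrix_mult Q_meas B_meas)

  have E_null: "E i k \<in> null_sets M" if "i \<noteq> k" for i k
    unfolding M_def
  proof (rule null_sets_PiM_lborel_if_unique_coordinate[OF fin])
    let ?c = "(1, (i, i), b)"
    show "?c \<in> I"
      using b order_refl[OF po] by (simp add: I_def coord_index_def)
    have "E i k \<in> sets M"
      unfolding E_def by measurable
    then show "E i k \<in> sets (Pi\<^sub>M I (\<lambda>_. lborel))"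
      by (simp add: M_def)
    fix x t assume "x \<in> E i k" "x(?c := t) \<in> E i k"
    moreover have "A (x(?c := t)) = A x + matrix_unit i i ((t - x ?c) *\<^sub>R b)"
      unfolding A_def by (subst coord_matrix_upd[OF order_refl[OF po] b]) simp
    ultimately have "(t - x ?c) *\<^sub>R b = 0"
      using \<open>i \<noteq> k\<close> by (auto simp: E_def matrix_unit_component)
    then show "t = x ?c"
      using b0 by simp
  qed
  have F_null: "F i j \<in> null_sets M" if "(i, j) \<in> r" for i j
    unfolding M_def
  proof (rule null_sets_PiM_lborel_if_unique_coordinate[OF fin])
    let ?c = "(2, (i, j), b)"
    show "?c \<in> I"
      using b that by (simp add: I_def coord_index_def)
    have "F i j \<in> sets M"
      unfolding F_def by measurable
    then show "F i j \<in> sets (Pi\<^sub>M I (\<lambda>_. lborel))"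
      by (simp add: M_def)
    fix x t assume x: "x \<in> F i j" and y: "x(?c := t) \<in> F i j"
    have A_upd: "A (x(?c := t)) = A x"
      unfolding A_def by (subst coord_matrix_upd[OF that b]) simp
    have B_upd: "B (x(?c := t)) = B x + matrix_unit i j ((t - x ?c) *\<^sub>R b)"
      unfolding B_def by (subst coord_matrix_upd[OF that b]) simp
    have "g i j (x(?c := t)) = g i j x +
        spectral_factor (A x) i $ i $ i * ((t - x ?c) *\<^sub>R b) * spectral_factor (A x) j $ j $ j"
      by (simp only: g_def A_upd B_upd matrix_add_ldistrib matrix_mult_add_rdistrib vector_add_component
          sandwich_matrix_unit_component)
    then have "(t - x ?c) *\<^sub>R b = 0"
      using x y by (simp add: F_def)
    then show "t = x ?c"
      using b0 by simp
  qed
  define Z where "Z = (\<Union>(i, k)\<in>{(i, k). i \<noteq> k}. E i k) \<union> (\<Union>(i, j)\<in>r. F i j)"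
  have "Z \<in> null_sets M"
    unfolding Z_def using E_null F_null by (auto intro!: null_sets_UN' null_sets.Un countable_finite)
  moreover have "coords r p \<in> Z" if p: "p \<in> incidence_algebra r \<times> incidence_algebra r - Gen2 r" for p
  proof (rule ccontr)
    let ?x = "coords r p"
    assume notZ: "?x \<notin> Z"
    have sp: "?x \<in> space M"
      by (auto simp: M_def I_def space_PiM coords_def split: prod.splits)
    have dist: "A ?x $ i $ i - A ?x $ k $ k \<noteq> 0" if "i \<noteq> k" for i k
      using notZ sp that by (auto simp: Z_def E_def)
    have "spectral_factor (A ?x) i $ i $ i \<noteq> 0" for i
      using dist by (auto simp: spectral_factor_diagonal[OF po A_in])
    then have "g i j ?x \<noteq> 0" if "(i, j) \<in> r" for i j
      using notZ sp that by (auto simp: Z_def F_def)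
    then have "(A ?x, B ?x) \<in> Gen2 r"
      by (intro Gen2I[OF po A_in B_in]) (auto simp: g_def)
    moreover have "(A ?x, B ?x) = p"
      using p coord_matrix_coords by (auto simp: A_def B_def)
    ultimately show False
      using p by simp
  qed
  ultimately show ?thesis
    unfolding M_def by blast
qed

section \<open>Cones over subsets of the sphere\<close>

lemma scaleR_eq_mat_mult:
  "t *\<^sub>R (A :: 'a::real_normed_field ^ 'n::finite ^ 'n) = mat (of_real t) ** A"
  by (simp add: vec_eq_iff mat_mult_component) (simp add: scaleR_conv_of_real)

text \<open>The origin lies in the cone only because the sphere is nonempty; the normalized identity
  matrix provides a point.\<close>

lemma cone_over_unit_sphere:
  fixes r :: "('n::finite \<times> 'n) set"
  assumes po: "partial_order_on UNIV r"
  shows "cone_over (unit_sphere r :: (('a::real_normed_field ^ 'n ^ 'n) \<times> ('a ^ 'n ^ 'n)) set) =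
    {p \<in> incidence_algebra r \<times> incidence_algebra r. norm p \<le> 1}"
proof -
  have scale: "t *\<^sub>R p \<in> incidence_algebra r \<times> incidence_algebra r"
    if "p \<in> incidence_algebra r \<times> incidence_algebra r" for t and p :: "('a ^ 'n ^ 'n) \<times> ('a ^ 'n ^ 'n)"
    using that by (auto simp: incidence_algebra_def)
  have normalize: "(1 / norm p) *\<^sub>R p \<in> unit_sphere r"
    if "p \<in> incidence_algebra r \<times> incidence_algebra r" "p \<noteq> 0"
    for p :: "('a ^ 'n ^ 'n) \<times> ('a ^ 'n ^ 'n)"
    using that scale by (simp add: unit_sphere_def)
  have "p \<in> cone_over (unit_sphere r)"
    if p: "p \<in> incidence_algebra r \<times> incidence_algebra r" "norm p \<le> 1"
    for p :: "('a ^ 'n ^ 'n) \<times> ('a ^ 'n ^ 'n)"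
  proof (cases "p = 0")
    case True
    have "(mat 1 :: 'a ^ 'n ^ 'n) \<noteq> 0"
      by (simp add: vec_eq_iff mat_def)
    then have "\<exists>s. s \<in> (unit_sphere r :: (('a ^ 'n ^ 'n) \<times> ('a ^ 'n ^ 'n)) set)"
      using normalize[of "(mat 1, 0)"] incidence_algebra_mat[OF po, of "1 :: 'a"]
        incidence_algebra_mat[OF po, of "0 :: 'a"] by (auto simp: zero_prod_def)
    then show ?thesis
      unfolding cone_over_def using True by (auto intro!: exI[of _ "0 :: real"])
  next
    case False
    have "p = norm p *\<^sub>R ((1 / norm p) *\<^sub>R p)"
      using False by simp
    with normalize[OF p(1) False] p(2) show ?thesis
      unfolding cone_over_def
      by (intro UN_I[of "(1 / norm p) *\<^sub>R p"]) (auto intro: exI[of _ "norm p"])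
  qed
  moreover have "p \<in> incidence_algebra r \<times> incidence_algebra r \<and> norm p \<le> 1"
    if p: "p \<in> cone_over (unit_sphere r)" for p :: "('a ^ 'n ^ 'n) \<times> ('a ^ 'n ^ 'n)"
  proof -
    from p obtain s t where "s \<in> unit_sphere r" "p = t *\<^sub>R s" "t \<in> {0..1}"
      by (auto simp: cone_over_def)
    then show ?thesis
      using scale by (auto simp: unit_sphere_def simp del: scaleR_Pair)
  qed
  ultimately show ?thesis by blast
qed

lemma coords_cone_over_unit_sphere:
  fixes r :: "('n::finite \<times> 'n) set"
  assumes po: "partial_order_on UNIV r"
  shows "coords r ` cone_over
      (unit_sphere r :: (('a::{real_normed_field, euclidean_space} ^ 'n ^ 'n) \<times> ('a ^ 'n ^ 'n)) set) =
    {x \<in> space (Pi\<^sub>M (coord_index r) (\<lambda>_. lborel)). L2_set x (coord_index r) \<le> 1}"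
proof -
  let ?ball = "{p :: ('a ^ 'n ^ 'n) \<times> ('a ^ 'n ^ 'n).
    p \<in> incidence_algebra r \<times> incidence_algebra r \<and> norm p \<le> 1}"
  have "coords r ` ?ball = {x \<in> space (Pi\<^sub>M (coord_index r) (\<lambda>_. lborel)). L2_set x (coord_index r) \<le> 1}"
  proof (rule subset_antisym; rule subsetI)
    fix x :: "nat \<times> ('n \<times> 'n) \<times> 'a \<Rightarrow> real" assume "x \<in> coords r ` ?ball"
    then obtain p where p: "p \<in> incidence_algebra r \<times> incidence_algebra r" "norm p \<le> 1" "x = coords r p"
      by auto
    then show "x \<in> {x \<in> space (Pi\<^sub>M (coord_index r) (\<lambda>_. lborel)). L2_set x (coord_index r) \<le> 1}"
      using norm_eq_L2_coords[OF p(1)] by (auto simp: space_PiM coords_def split: prod.splits)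
  next
    fix x :: "nat \<times> ('n \<times> 'n) \<times> 'a \<Rightarrow> real"
    assume x: "x \<in> {x \<in> space (Pi\<^sub>M (coord_index r) (\<lambda>_. lborel)). L2_set x (coord_index r) \<le> 1}"
    define p where "p = (coord_matrix r 1 x, coord_matrix r 2 x)"
    have "x \<in> extensional (coord_index r)"
      using x by (auto simp: space_PiM PiE_def)
    then have "coords r p = x"
      unfolding p_def by (rule coords_coord_matrix)
    moreover have p: "p \<in> incidence_algebra r \<times> incidence_algebra r"
      by (simp add: p_def coord_matrix_in_incidence_algebra)
    ultimately show "x \<in> coords r ` ?ball"
      using x norm_eq_L2_coords[OF p] by (intro image_eqI[of _ _ p]) auto
  qed
  then show ?thesis
    by (simp only: cone_over_unit_sphere[OF po])
qed

lemma L2_ball_measurable: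
  "{x \<in> space (Pi\<^sub>M I (\<lambda>_. lborel)). L2_set x I \<le> 1} \<in> sets (Pi\<^sub>M I (\<lambda>_. lborel))"
  unfolding L2_set_def by measurable

text \<open>Positivity of the real-valued measure needs finiteness too; the ball lies between two cubes.\<close>

lemma measure_L2_ball_pos:
  fixes I :: "'i set"
  assumes I: "finite I"
  shows "measure (Pi\<^sub>M I (\<lambda>_. lborel)) {x \<in> space (Pi\<^sub>M I (\<lambda>_. lborel)). L2_set x I \<le> 1} > 0"
proof -
  interpret product_sigma_finite "\<lambda>_ :: 'i. lborel :: real measure" ..
  let ?M = "Pi\<^sub>M I (\<lambda>_. lborel :: real measure)"
  let ?K = "{x \<in> space ?M. L2_set x I \<le> 1}"
  have cube: "emeasure ?M (\<Pi>\<^sub>E i\<in>I. {- e..e}) = ennreal ((2 * e) ^ card I)" if "e \<ge> 0" for e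
    using that I by (simp add: emeasure_PiM ennreal_power)
  \<comment> \<open>adding \<open>1\<close> keeps \<open>e\<close> a positive number when \<open>I\<close> is empty\<close>
  define e where "e = 1 / (real (card I) + 1)"
  have e: "e > 0" "real (card I) * e \<le> 1"
    by (simp_all add: e_def)
  have "(\<Pi>\<^sub>E i\<in>I. {- e..e}) \<subseteq> ?K"
  proof
    fix x assume x: "x \<in> (\<Pi>\<^sub>E i\<in>I. {- e..e})"
    have "L2_set x I \<le> (\<Sum>i\<in>I. \<bar>x i\<bar>)"
      by (rule L2_set_le_sum_abs)
    also have "\<dots> \<le> (\<Sum>i\<in>I. e)"
      using x by (intro sum_mono) (auto simp: PiE_iff abs_le_iff minus_le_iff)
    also have "\<dots> \<le> 1"
      using e by simp
    finally show "x \<in> ?K"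
      using x by (auto simp: space_PiM PiE_iff)
  qed
  then have "emeasure ?M (\<Pi>\<^sub>E i\<in>I. {- e..e}) \<le> emeasure ?M ?K"
    by (rule emeasure_mono) (rule L2_ball_measurable)
  moreover have "0 < emeasure ?M (\<Pi>\<^sub>E i\<in>I. {- e..e})"
    using cube[of e] e(1) by simp
  ultimately have pos: "emeasure ?M ?K > 0"
    by (rule less_le_trans[rotated])
  have "?K \<subseteq> (\<Pi>\<^sub>E i\<in>I. {- 1..1})"
  proof
    fix x assume x: "x \<in> ?K"
    have "\<bar>x i\<bar> \<le> 1" if "i \<in> I" for i
    proof -
      have "L2_set (\<lambda>i. \<bar>x i\<bar>) I \<le> 1"
        using x by (simp add: L2_set_def)
      then show ?thesis
        using member_le_L2_set[OF I that, of "\<lambda>i. \<bar>x i\<bar>"] by simp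
    qed
    then show "x \<in> (\<Pi>\<^sub>E i\<in>I. {- 1..1})"
      using x by (auto simp: space_PiM PiE_iff abs_le_iff minus_le_iff)
  qed
  then have "emeasure ?M ?K \<le> emeasure ?M (\<Pi>\<^sub>E i\<in>I. {- 1..1})"
    using I by (intro emeasure_mono sets_PiM_I_finite) auto
  also have "\<dots> < \<infinity>"
    using cube[of 1] by simp
  finally have "emeasure ?M ?K < \<infinity>" .
  with pos show ?thesis
    by (simp add: measure_def enn2real_positive_iff)
qed

lemma sphere_prob_Gen2:
  fixes r :: "('n::finite \<times> 'n) set"
  assumes po: "partial_order_on UNIV r"
  defines "G \<equiv> unit_sphere r \<inter> Gen2 r ::
    (('a::{real_normed_field, euclidean_space} ^ 'n ^ 'n) \<times> ('a ^ 'n ^ 'n)) set"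
  shows "sphere_measurable r G \<and> sphere_prob r G = 1"
proof -
  define S where "S = (unit_sphere r :: (('a ^ 'n ^ 'n) \<times> ('a ^ 'n ^ 'n)) set)"
  let ?I = "coord_index r :: (nat \<times> ('n \<times> 'n) \<times> 'a) set"
  let ?M = "Pi\<^sub>M ?I (\<lambda>_. lborel :: real measure)"
  let ?K = "coords r ` cone_over S"
  let ?D = "coords r ` (cone_over S - cone_over G)"
  obtain Z where Z: "Z \<in> null_sets ?M"
    and bad: "\<And>p. p \<in> incidence_algebra r \<times> incidence_algebra r - Gen2 r \<Longrightarrow> coords r p \<in> Z"
    using null_sets_not_Gen2_coords[OF po] by blast
  have subset: "cone_over G \<subseteq> cone_over S"
    by (auto simp: cone_over_def G_def S_def)
  have S_alg: "cone_over S \<subseteq> incidence_algebra r \<times> incidence_algebra r"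
    unfolding S_def using cone_over_unit_sphere[OF po] by blast
  \<comment> \<open>if \<open>p = t *\<^sub>R s\<close> generates then so does \<open>s\<close>, which puts \<open>p\<close> into the smaller cone\<close>
  have "p \<notin> Gen2 r" if p: "p \<in> cone_over S - cone_over G" for p
  proof
    assume gen: "p \<in> Gen2 r"
    from p obtain s t where s: "s \<in> S" "p = t *\<^sub>R s" "t \<in> {0..1}"
      by (auto simp: cone_over_def)
    then have "s \<in> Gen2 r"
      using gen Gen2_mult_mat[OF po, of "fst s" "snd s" "of_real t"]
      by (cases s) (auto simp: S_def unit_sphere_def scaleR_eq_mat_mult)
    with s have "p \<in> cone_over G"
      by (auto simp: cone_over_def G_def S_def)
    with p show False by simp
  qed
  with bad S_alg have "?D \<subseteq> Z"
    by blast
  with Z have D: "?D \<in> null_sets (lebesgue_coords r)"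
    unfolding lebesgue_coords_def null_sets_completion_iff2 by blast
  have K: "?K = {x \<in> space ?M. L2_set x ?I \<le> 1}"
    unfolding S_def by (rule coords_cone_over_unit_sphere[OF po])
  have K_sets: "?K \<in> sets ?M"
    unfolding K by (rule L2_ball_measurable)
  then have K_sets': "?K \<in> sets (lebesgue_coords r)"
    by (simp add: lebesgue_coords_def)
  have "inj_on (coords r) (incidence_algebra r \<times> incidence_algebra r ::
      (('a ^ 'n ^ 'n) \<times> ('a ^ 'n ^ 'n)) set)"
    by (rule inj_on_inverseI[of _ "\<lambda>x. (coord_matrix r 1 x, coord_matrix r 2 x)"])
       (use coord_matrix_coords in auto)
  then have "inj_on (coords r) (cone_over S)"
    using S_alg by (rule inj_on_subset)
  then have "?D = ?K - coords r ` cone_over G"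
    using subset by (rule inj_on_image_set_diff[OF _ Diff_subset])
  then have G_image: "coords r ` cone_over G = ?K - ?D"
    using subset by blast
  have "measure (lebesgue_coords r) (coords r ` cone_over G) = measure (lebesgue_coords r) ?K"
    unfolding G_image using K_sets' D by (rule measure_Diff_null_set)
  moreover have "measure (lebesgue_coords r) ?K > 0"
    using measure_L2_ball_pos[of ?I] K_sets by (simp add: lebesgue_coords_def K coord_index_def)
  moreover have "coords r ` cone_over G \<in> sets (lebesgue_coords r)"
    unfolding G_image using K_sets' D by blast
  ultimately show ?thesis
    by (simp add: sphere_measurable_def sphere_prob_def S_def) (simp add: G_def)
qed

theorem corollary10:
  fixes r :: "('n::finite \<times> 'n) set"
  assumes "partial_order_on UNIV r"
  shows "(sphere_measurable r (unit_sphere r \<inter> Gen2 r :: ((real ^ 'n ^ 'n) \<times> (real ^ 'n ^ 'n)) set) \<and>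
          sphere_prob r (unit_sphere r \<inter> Gen2 r :: ((real ^ 'n ^ 'n) \<times> (real ^ 'n ^ 'n)) set) = 1) \<and>
         (sphere_measurable r (unit_sphere r \<inter> Gen2 r :: ((complex ^ 'n ^ 'n) \<times> (complex ^ 'n ^ 'n)) set) \<and>
          sphere_prob r (unit_sphere r \<inter> Gen2 r :: ((complex ^ 'n ^ 'n) \<times> (complex ^ 'n ^ 'n)) set) = 1)"
  by (rule conjI; rule sphere_prob_Gen2[OF assms])

end
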